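(* Let $Q$ be a commutative involutive quantale which is zero-divisor free, let $X$ be a set and let $\mathbf{A}$ be an object of $\mathbf{Rel}_Q\text{-}\mathbf{Alg}_{\mathrm{vN}}(X)$. Then there is a family $\{e_i\}$ of primitive subunital idempotents of $\mathbf{A}$ such that $\mathbf{A}=\prod_i e_i\mathbf{A}$ is a direct product of semialgebras with involution (over $Q$).
   Context: A commutative involutive quantale $(Q,\bigvee,\cdot,1_Q,{}^* )$ is a complete join-semilattice with a commutative monoid operation $\cdot$ (unit $1_Q$) distributing over arbitrary joins, with a join-preserving involution ${}^*$ satisfying $(x\cdot y)^*=y^*\cdot x^*$, $1_Q^*=1_Q$; its least element is $0$, and $0\neq\top$ is assumed. $Q$ is zero-divisor free (ZDF) if $x\cdot y=0$ implies $x=0$ or $y=0$. The category $\mathbf{Rel}_Q$: objects are sets, morphisms $f:X\to Y$ are functions $X\times Y\to Q$, composition $(g\circ f)(x,z)=\bigvee_y f(x,y)\cdot g(y,z)$, identity $\mathrm{id}_X(x,y)=1_Q$ if $x=y$, else $0$; dagger $f^\dagger(y,x)=f(x,y)^*$. $\mathrm{Hom}(X,X)$ is a $Q$-semialgebra with addition pointwise join, multiplication composition, scalar multiplication $(q\bullet f)(x,y)=q\cdot f(x,y)$, involution $\dagger$. The commutant of $B\subseteq\mathrm{Hom}(X,X)$ is $B'=\{f: f\circ g=g\circ f\ \forall g\in B\}$. Objects of $\mathbf{Rel}_Q\text{-}\mathbf{Alg}_{\mathrm{vN}}(X)$ are subsets $\mathbf{A}\subseteq\mathrm{Hom}(X,X)$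 containing $0$ and $\mathrm{id}_X$, closed under binary joins, composition, scalar multiplication and $\dagger$, commutative under composition, with $\mathbf{A}=\mathbf{A}''$. In $\mathbf{A}$ (with unit $1_{\mathbf{A}}=\mathrm{id}_X$ and addition $+$ the join), nonzero $s,t$ are orthogonal if $s\circ t=0$; a subunital idempotent is an idempotent $p$ for which there is an orthogonal idempotent $q$ with $p+q=1_{\mathbf{A}}$; a primitive subunital idempotent is a subunital idempotent $p$ which cannot be written as $p=s+t$ with $s,t$ non-trivial subunital idempotents. For an idempotent $e$, $e\mathbf{A}=\{e\circ f: f\in\mathbf{A}\}$, a semialgebra with unit $e$.
   Formalization: A subunital idempotent may have complement 0 (so 0 and the unit are subunital), and "non-trivial" summands of a primitive p means different from 0 and p, with p nonzero; read literally, the claim fails for X a singleton, and p = p + p would make no p primitive. *)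

theory Defs
  imports "HOL-Algebra.Module"
begin

text \<open>Every complete join-semilattice is a complete lattice; the least element \<open>0\<close> of the
  quantale is \<^term>\<open>bot\<close>, and its unit is the \<^term>\<open>1\<close> of the class
  \<^class>\<open>comm_monoid_mult\<close>.\<close>

class comm_inv_quantale = complete_lattice + comm_monoid_mult +
  fixes star :: "'a \<Rightarrow> 'a"
  assumes mult_Sup: "x * Sup S = (SUP y\<in>S. x * y)"
    and star_Sup: "star (Sup S) = (SUP y\<in>S. star y)"
    and star_star: "star (star x) = x"
    and star_mult: "star (x * y) = star y * star x"
    and star_one: "star 1 = 1"
    and bot_neq_top: "bot \<noteq> top"

text \<open>Morphisms \<open>X \<rightarrow> Y\<close> are functions on the set \<open>X \<times> Y\<close>. They are represented by extensional
  functions, so that equality of representatives is equality on \<open>X \<times> Y\<close>; the objects are sets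
  (not types), so that the empty object is included.\<close>

type_synonym ('x, 'y, 'q) qrel = "'x \<times> 'y \<Rightarrow> 'q"

definition qhom :: "'x set \<Rightarrow> 'y set \<Rightarrow> ('x, 'y, 'q) qrel set" where
  "qhom X Y = (X \<times> Y) \<rightarrow>\<^sub>E UNIV"

definition qcomp :: "'x set \<Rightarrow> 'y set \<Rightarrow> 'z set \<Rightarrow>
    ('y, 'z, 'q::comm_inv_quantale) qrel \<Rightarrow> ('x, 'y, 'q) qrel \<Rightarrow> ('x, 'z, 'q) qrel" where
  "qcomp X Y Z g f = (\<lambda>(x, z)\<in>X \<times> Z. SUP y\<in>Y. f (x, y) * g (y, z))"

definition qid :: "'x set \<Rightarrow> ('x, 'x, 'q::comm_inv_quantale) qrel" where
  "qid X = (\<lambda>(x, y)\<in>X \<times> X. if x = y then 1 else bot)"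

definition qdagger :: "'x set \<Rightarrow> 'y set \<Rightarrow>
    ('x, 'y, 'q::comm_inv_quantale) qrel \<Rightarrow> ('y, 'x, 'q) qrel" where
  "qdagger X Y f = (\<lambda>(y, x)\<in>Y \<times> X. star (f (x, y)))"

definition qzero :: "'x set \<Rightarrow> 'y set \<Rightarrow> ('x, 'y, 'q::comm_inv_quantale) qrel" where
  "qzero X Y = (\<lambda>_\<in>X \<times> Y. bot)"

definition qjoin :: "'x set \<Rightarrow> 'y set \<Rightarrow>
    ('x, 'y, 'q::comm_inv_quantale) qrel \<Rightarrow> ('x, 'y, 'q) qrel \<Rightarrow> ('x, 'y, 'q) qrel" where
  "qjoin X Y f g = (\<lambda>p\<in>X \<times> Y. sup (f p) (g p))"

definition qscale :: "'x set \<Rightarrow> 'y set \<Rightarrow>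
    'q::comm_inv_quantale \<Rightarrow> ('x, 'y, 'q) qrel \<Rightarrow> ('x, 'y, 'q) qrel" where
  "qscale X Y q f = (\<lambda>p\<in>X \<times> Y. q * f p)"

text \<open>Semialgebras with involution over a commutative involutive quantale, regarded as a semiring
  with addition \<^term>\<open>sup\<close> and zero \<^term>\<open>bot\<close>.\<close>

record ('q, 'a) inv_semialg = "('q, 'a) module" +
  invol :: "'a \<Rightarrow> 'a"

locale inv_semialgebra = semiring A
  for A :: "('q::comm_inv_quantale, 'a, 'm) inv_semialg_scheme" (structure) +
  assumes smult_closed: "x \<in> carrier A \<Longrightarrow> q \<odot> x \<in> carrier A"
    and smult_l_distr: "x \<in> carrier A \<Longrightarrow> sup q r \<odot> x = q \<odot> x \<oplus> r \<odot> x"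
    and smult_r_distr: "\<lbrakk>x \<in> carrier A; y \<in> carrier A\<rbrakk> \<Longrightarrow> q \<odot> (x \<oplus> y) = q \<odot> x \<oplus> q \<odot> y"
    and smult_assoc1: "x \<in> carrier A \<Longrightarrow> (q * r) \<odot> x = q \<odot> (r \<odot> x)"
    and smult_one: "x \<in> carrier A \<Longrightarrow> 1 \<odot> x = x"
    and smult_l_null: "x \<in> carrier A \<Longrightarrow> bot \<odot> x = \<zero>"
    and smult_r_null: "q \<odot> \<zero> = \<zero>"
    and smult_assoc2: "\<lbrakk>x \<in> carrier A; y \<in> carrier A\<rbrakk> \<Longrightarrow> (q \<odot> x) \<otimes> y = q \<odot> (x \<otimes> y)"
    and smult_assoc3: "\<lbrakk>x \<in> carrier A; y \<in> carrier A\<rbrakk> \<Longrightarrow> x \<otimes> (q \<odot> y) = q \<odot> (x \<otimes> y)"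
    and invol_closed: "x \<in> carrier A \<Longrightarrow> invol A x \<in> carrier A"
    and invol_invol: "x \<in> carrier A \<Longrightarrow> invol A (invol A x) = x"
    and invol_add: "\<lbrakk>x \<in> carrier A; y \<in> carrier A\<rbrakk>
      \<Longrightarrow> invol A (x \<oplus> y) = invol A x \<oplus> invol A y"
    and invol_mult: "\<lbrakk>x \<in> carrier A; y \<in> carrier A\<rbrakk>
      \<Longrightarrow> invol A (x \<otimes> y) = invol A y \<otimes> invol A x"
    and invol_smult: "x \<in> carrier A \<Longrightarrow> invol A (q \<odot> x) = star q \<odot> invol A x"

definition inv_semialg_iso ::
  "('q::comm_inv_quantale, 'a, 'm) inv_semialg_scheme \<Rightarrow> ('q, 'b, 'n) inv_semialg_scheme
    \<Rightarrow> ('a \<Rightarrow> 'b) set" where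
  "inv_semialg_iso A B = {h. bij_betw h (carrier A) (carrier B) \<and>
    h \<zero>\<^bsub>A\<^esub> = \<zero>\<^bsub>B\<^esub> \<and> h \<one>\<^bsub>A\<^esub> = \<one>\<^bsub>B\<^esub> \<and>
    (\<forall>x\<in>carrier A. \<forall>y\<in>carrier A. h (x \<oplus>\<^bsub>A\<^esub> y) = h x \<oplus>\<^bsub>B\<^esub> h y) \<and>
    (\<forall>x\<in>carrier A. \<forall>y\<in>carrier A. h (x \<otimes>\<^bsub>A\<^esub> y) = h x \<otimes>\<^bsub>B\<^esub> h y) \<and>
    (\<forall>q. \<forall>x\<in>carrier A. h (q \<odot>\<^bsub>A\<^esub> x) = q \<odot>\<^bsub>B\<^esub> h x) \<and>
    (\<forall>x\<in>carrier A. h (invol A x) = invol B (h x))}"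

definition inv_semialg_prod ::
  "'i set \<Rightarrow> ('i \<Rightarrow> ('q::comm_inv_quantale, 'a) inv_semialg) \<Rightarrow> ('q, 'i \<Rightarrow> 'a) inv_semialg" where
  "inv_semialg_prod I B = \<lparr>
    carrier = (\<Pi>\<^sub>E i\<in>I. carrier (B i)),
    mult = (\<lambda>x y. \<lambda>i\<in>I. x i \<otimes>\<^bsub>B i\<^esub> y i),
    one = (\<lambda>i\<in>I. \<one>\<^bsub>B i\<^esub>),
    zero = (\<lambda>i\<in>I. \<zero>\<^bsub>B i\<^esub>),
    add = (\<lambda>x y. \<lambda>i\<in>I. x i \<oplus>\<^bsub>B i\<^esub> y i),
    smult = (\<lambda>q x. \<lambda>i\<in>I. q \<odot>\<^bsub>B i\<^esub> x i),
    invol = (\<lambda>x. \<lambda>i\<in>I. invol (B i) (x i))\<rparr>"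

text \<open>Here \<open>p\<close> and its orthogonal complement \<open>q\<close> may be zero: the zero and the unit are the
  trivial subunital idempotents. Requiring both to be nonzero would exclude the unit, which has to
  be admitted (and is primitive) when there are no other subunital idempotents.\<close>

definition subunital_idempotent :: "('q, 'a, 'm) inv_semialg_scheme \<Rightarrow> 'a \<Rightarrow> bool" where
  "subunital_idempotent A p \<longleftrightarrow> p \<in> carrier A \<and> p \<otimes>\<^bsub>A\<^esub> p = p \<and>
    (\<exists>q\<in>carrier A. q \<otimes>\<^bsub>A\<^esub> q = q \<and> p \<otimes>\<^bsub>A\<^esub> q = \<zero>\<^bsub>A\<^esub> \<and> p \<oplus>\<^bsub>A\<^esub> q = \<one>\<^bsub>A\<^esub>)"

text \<open>The summands are non-trivial relative to \<open>p\<close>, i.e. different from \<open>0\<close> and \<open>p\<close>: as addition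
  is a join, every \<open>p\<close> has the decomposition \<open>p = p + p\<close>, which must not count. The zero is not
  primitive.\<close>

definition primitive_subunital_idempotent :: "('q, 'a, 'm) inv_semialg_scheme \<Rightarrow> 'a \<Rightarrow> bool" where
  "primitive_subunital_idempotent A p \<longleftrightarrow> subunital_idempotent A p \<and> p \<noteq> \<zero>\<^bsub>A\<^esub> \<and>
    \<not> (\<exists>s t. subunital_idempotent A s \<and> subunital_idempotent A t \<and>
          s \<notin> {\<zero>\<^bsub>A\<^esub>, p} \<and> t \<notin> {\<zero>\<^bsub>A\<^esub>, p} \<and> p = s \<oplus>\<^bsub>A\<^esub> t)"

definition corner :: "('q, 'a, 'm) inv_semialg_scheme \<Rightarrow> 'a \<Rightarrow> ('q, 'a, 'm) inv_semialg_scheme" where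
  "corner A e = A\<lparr>carrier := {e \<otimes>\<^bsub>A\<^esub> f | f. f \<in> carrier A}, one := e\<rparr>"

definition end_semialg ::
  "'x set \<Rightarrow> ('q::comm_inv_quantale, ('x, 'x, 'q) qrel) inv_semialg" where
  "end_semialg X = \<lparr>
    carrier = qhom X X,
    mult = qcomp X X X,
    one = qid X,
    zero = qzero X X,
    add = qjoin X X,
    smult = qscale X X,
    invol = qdagger X X\<rparr>"

definition commutant ::
  "'x set \<Rightarrow> ('x, 'x, 'q::comm_inv_quantale) qrel set \<Rightarrow> ('x, 'x, 'q) qrel set" where
  "commutant X B = {f \<in> qhom X X. \<forall>g\<in>B. qcomp X X X f g = qcomp X X X g f}"

definition vN_object :: "'x set \<Rightarrow> ('x, 'x, 'q::comm_inv_quantale) qrel set \<Rightarrow> bool" where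
  "vN_object X A \<longleftrightarrow> A \<subseteq> qhom X X \<and> qzero X X \<in> A \<and> qid X \<in> A \<and>
    (\<forall>f\<in>A. \<forall>g\<in>A. qjoin X X f g \<in> A) \<and>
    (\<forall>f\<in>A. \<forall>g\<in>A. qcomp X X X f g \<in> A) \<and>
    (\<forall>q. \<forall>f\<in>A. qscale X X q f \<in> A) \<and>
    (\<forall>f\<in>A. qdagger X X f \<in> A) \<and>
    (\<forall>f\<in>A. \<forall>g\<in>A. qcomp X X X f g = qcomp X X X g f) \<and>
    A = commutant X (commutant X A)"

definition vN_semialg ::
  "'x set \<Rightarrow> ('x, 'x, 'q) qrel set \<Rightarrow> ('q::comm_inv_quantale, ('x, 'x, 'q) qrel) inv_semialg" where
  "vN_semialg X A = (end_semialg X)\<lparr>carrier := A\<rparr>"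

text \<open>\<open>A\<close> is the (internal) direct product of the \<open>e i A\<close>: these are semialgebras with involution,
  and the canonical map \<open>f \<mapsto> (e i \<otimes> f)\<^sub>i\<close> is an isomorphism onto their product.\<close>

definition is_direct_product_of_corners ::
  "('q::comm_inv_quantale, 'a) inv_semialg \<Rightarrow> 'i set \<Rightarrow> ('i \<Rightarrow> 'a) \<Rightarrow> bool" where
  "is_direct_product_of_corners A I e \<longleftrightarrow>
    inv_semialgebra A \<and> (\<forall>i\<in>I. inv_semialgebra (corner A (e i))) \<and>
    (\<lambda>f. \<lambda>i\<in>I. e i \<otimes>\<^bsub>A\<^esub> f) \<in> inv_semialg_iso A (inv_semialg_prod I (\<lambda>i. corner A (e i)))"

end

theory Submission
  imports Defs
begin

text \<open>Without zero divisors, \<open>p + q = 1\<close> and \<open>p q = 0\<close> force \<open>p\<close> to be diagonal with entries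
  \<open>0\<close> and \<open>1\<close>, so a subunital idempotent is the indicator of a subset of \<open>X\<close>. As \<open>A = A''\<close>, such
  an indicator lies in \<open>A\<close> iff the subset is a union of connected components of \<open>X\<close>, two points
  being adjacent if some element of \<open>A'\<close> has a nonzero entry there. The components give the
  primitive idempotents. Elements of \<open>A \<subseteq> A'\<close> are block diagonal, and any choice of blocks from
  the corners glues to a matrix that commutes with the block diagonal matrices in \<open>A'\<close>, hence
  lies in \<open>A''\<close>.\<close>

section \<open>Quantales\<close>

context comm_inv_quantale
begin

lemma mult_bot: "x * bot = bot"
  using mult_Sup[of x "{}"] by simp

lemma bot_mult: "bot * x = bot"
  using mult_bot mult.commute by metis

lemma mult_SUP: "x * (SUP i\<in>I. f i) = (SUP i\<in>I. x * f i)"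
  by (simp add: mult_Sup image_image)

lemma SUP_mult: "(SUP i\<in>I. f i) * x = (SUP i\<in>I. f i * x)"
  using mult_SUP[of x f I] by (simp add: mult.commute)

lemma mult_sup: "x * sup y z = sup (x * y) (x * z)"
  using mult_Sup[of x "{y, z}"] by simp

lemma sup_mult: "sup y z * x = sup (y * x) (z * x)"
  using mult_sup[of x y z] by (simp add: mult.commute)

lemma star_SUP: "star (SUP i\<in>I. f i) = (SUP i\<in>I. star (f i))"
  by (simp add: star_Sup image_image)

lemma star_bot: "star bot = bot"
  using star_Sup[of "{}"] by simp

lemma star_sup: "star (sup x y) = sup (star x) (star y)"
  using star_Sup[of "{x, y}"] by simp

text \<open>If \<open>1 = bot\<close>, then every \<open>x = x * 1\<close> is \<open>bot\<close>,
  contrary to \<open>bot_neq_top\<close>. This keeps the indicators of different subsets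
  apart.\<close>

lemma one_neq_bot: "1 \<noteq> bot"
proof
  assume "1 = bot"
  then have "x = bot" for x
    using mult_bot[of x] by (metis mult_1_right)
  then show False using bot_neq_top by metis
qed

text \<open>Serves for composites with a diagonal matrix, where only one intermediate point
  contributes.\<close>

lemma SUP_unique:
  assumes "a \<in> Y" and "\<And>y. y \<in> Y \<Longrightarrow> y \<noteq> a \<Longrightarrow> f y = bot"
  shows "(SUP y\<in>Y. f y) = f a"
proof (rule order.antisym)
  show "(SUP y\<in>Y. f y) \<le> f a"
    using assms by (intro SUP_least) (metis bot_least order_refl)
qed (use assms in \<open>auto intro: SUP_upper\<close>)

end

section \<open>The semialgebra of endomorphisms\<close>

lemma qhom_eqI:
  assumes "f \<in> qhom X Y" "g \<in> qhom X Y"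
    and "\<And>x y. x \<in> X \<Longrightarrow> y \<in> Y \<Longrightarrow> f (x, y) = g (x, y)"
  shows "f = g"
  using assms unfolding qhom_def by (intro PiE_ext[of f _ _ g]) auto

lemma qhom_closed:
  "qcomp X Y Z g f \<in> qhom X Z" "qid X \<in> qhom X X" "qdagger X Y h \<in> qhom Y X"
  "qzero X Y \<in> qhom X Y" "qjoin X Y h k \<in> qhom X Y" "qscale X Y q h \<in> qhom X Y"
  by (auto simp: qhom_def qcomp_def qid_def qdagger_def qzero_def qjoin_def qscale_def
      PiE_def extensional_def)

lemma qrel_apply:
  "x \<in> X \<Longrightarrow> z \<in> Z \<Longrightarrow> qcomp X Y Z g f (x, z) = (SUP y\<in>Y. f (x, y) * g (y, z))"
  "x \<in> X \<Longrightarrow> x' \<in> X \<Longrightarrow> qid X (x, x') = (if x = x' then 1 else bot)"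
  "x \<in> X \<Longrightarrow> y \<in> Y \<Longrightarrow> qdagger X Y h (y, x) = star (h (x, y))"
  "x \<in> X \<Longrightarrow> y \<in> Y \<Longrightarrow> qzero X Y (x, y) = bot"
  "x \<in> X \<Longrightarrow> y \<in> Y \<Longrightarrow> qjoin X Y h k (x, y) = sup (h (x, y)) (k (x, y))"
  "x \<in> X \<Longrightarrow> y \<in> Y \<Longrightarrow> qscale X Y q h (x, y) = q * h (x, y)"
  by (simp_all add: qcomp_def qid_def qdagger_def qzero_def qjoin_def qscale_def)

lemma qcomp_assoc:
  "qcomp X Z W h (qcomp X Y Z g f) = qcomp X Y W (qcomp Y Z W h g) f"
proof (rule qhom_eqI[OF qhom_closed(1) qhom_closed(1)])
  fix x w assume "x \<in> X" "w \<in> W"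
  then have "qcomp X Z W h (qcomp X Y Z g f) (x, w) =
      (SUP z\<in>Z. SUP y\<in>Y. f (x, y) * (g (y, z) * h (z, w)))"
    by (simp add: qrel_apply SUP_mult mult.assoc)
  also have "\<dots> = (SUP y\<in>Y. SUP z\<in>Z. f (x, y) * (g (y, z) * h (z, w)))"
    by (rule SUP_commute)
  also have "\<dots> = qcomp X Y W (qcomp Y Z W h g) f (x, w)"
    using \<open>x \<in> X\<close> \<open>w \<in> W\<close> by (simp add: qrel_apply mult_SUP)
  finally show "qcomp X Z W h (qcomp X Y Z g f) (x, w) = qcomp X Y W (qcomp Y Z W h g) f (x, w)" .
qed

section \<open>Indicator matrices of subsets\<close>

definition qdiag :: "'x set \<Rightarrow> 'x set \<Rightarrow> ('x, 'x, 'q::comm_inv_quantale) qrel" where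
  "qdiag X S = (\<lambda>(x, y)\<in>X \<times> X. if x = y \<and> x \<in> S then 1 else bot)"

lemma qdiag_closed: "qdiag X S \<in> qhom X X"
  by (auto simp: qhom_def qdiag_def PiE_def extensional_def)

lemma qdiag_apply:
  "x \<in> X \<Longrightarrow> y \<in> X \<Longrightarrow> qdiag X S (x, y) = (if x = y \<and> x \<in> S then 1 else bot)"
  by (simp add: qdiag_def)

lemma qid_eq_qdiag: "qid X = qdiag X X"
  by (rule qhom_eqI[OF qhom_closed(2) qdiag_closed]) (simp add: qrel_apply qdiag_apply)

lemma qzero_eq_qdiag: "qzero X X = qdiag X {}"
  by (rule qhom_eqI[OF qhom_closed(4) qdiag_closed]) (simp add: qrel_apply qdiag_apply)

lemma qdiag_eq_iff:
  assumes "S \<subseteq> X" "T \<subseteq> X"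
  shows "(qdiag X S :: ('x, 'x, 'q::comm_inv_quantale) qrel) = qdiag X T \<longleftrightarrow> S = T"
proof
  assume eq: "(qdiag X S :: ('x, 'x, 'q) qrel) = qdiag X T"
  have "x \<in> S \<longleftrightarrow> x \<in> T" if "x \<in> X" for x
    using fun_cong[OF eq, of "(x, x)"] that one_neq_bot[where 'a='q]
    by (auto simp: qdiag_apply split: if_splits)
  then show "S = T" using assms by blast
qed simp

text \<open>\<open>qcomp\<close> applies its second argument first, so the left factor acts on the
  target coordinate and erases the columns outside \<open>S\<close>. A right factor erases
  rows.\<close>

lemma qcomp_qdiag_left:
  assumes "x \<in> X" "z \<in> X"
  shows "qcomp X X X (qdiag X S) f (x, z) = (if z \<in> S then f (x, z) else bot)"
proof -
  have "qcomp X X X (qdiag X S) f (x, z) = f (x, z) * qdiag X S (z, z)"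
    unfolding qrel_apply(1)[OF assms] using assms
    by (intro SUP_unique) (auto simp: qdiag_apply mult_bot)
  then show ?thesis using assms by (simp add: qdiag_apply mult_bot)
qed

lemma qcomp_qdiag_right:
  assumes "x \<in> X" "z \<in> X"
  shows "qcomp X X X f (qdiag X S) (x, z) = (if x \<in> S then f (x, z) else bot)"
proof -
  have "qcomp X X X f (qdiag X S) (x, z) = qdiag X S (x, x) * f (x, z)"
    unfolding qrel_apply(1)[OF assms] using assms
    by (intro SUP_unique) (auto simp: qdiag_apply bot_mult)
  then show ?thesis using assms by (simp add: qdiag_apply bot_mult)
qed

lemma qcomp_qdiag_qdiag: "qcomp X X X (qdiag X S) (qdiag X T) = qdiag X (S \<inter> T)"
  by (rule qhom_eqI[OF qhom_closed(1) qdiag_closed]) (auto simp: qcomp_qdiag_left qdiag_apply)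

lemma qjoin_qdiag_qdiag: "qjoin X X (qdiag X S) (qdiag X T) = qdiag X (S \<union> T)"
  by (rule qhom_eqI[OF qhom_closed(5) qdiag_closed]) (auto simp: qrel_apply qdiag_apply)

lemma qdagger_qdiag: "qdagger X X (qdiag X S) = qdiag X S"
  by (rule qhom_eqI[OF qhom_closed(3) qdiag_closed])
    (auto simp: qrel_apply qdiag_apply star_bot star_one)

lemma qcomp_qid_left: "f \<in> qhom X X \<Longrightarrow> qcomp X X X (qid X) f = f"
  by (rule qhom_eqI[OF qhom_closed(1)]) (auto simp: qid_eq_qdiag qcomp_qdiag_left)

lemma qcomp_qid_right: "f \<in> qhom X X \<Longrightarrow> qcomp X X X f (qid X) = f"
  by (rule qhom_eqI[OF qhom_closed(1)]) (auto simp: qid_eq_qdiag qcomp_qdiag_right)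

text \<open>The laws are checked entrywise; commutativity of the quantale lets scalars pass through
  composition and the dagger.\<close>

lemma inv_semialgebra_end:
  "inv_semialgebra (end_semialg X :: ('q::comm_inv_quantale, ('x, 'x, 'q) qrel) inv_semialg)"
  by unfold_locales
    (auto simp: end_semialg_def qhom_closed Units_def qcomp_assoc qcomp_qid_left qcomp_qid_right
      qrel_apply mult_bot bot_mult mult_sup sup_mult mult_SUP SUP_mult
      complete_lattice_class.SUP_sup_distrib[symmetric]
      star_SUP star_star star_mult star_sup sup.assoc mult.assoc mult.commute mult.left_commute
      intro!: qhom_eqI[of _ X X] cong: SUP_cong intro: sup.commute sup.left_commute)

section \<open>Subalgebras and corners\<close>

lemma (in inv_semialgebra) inv_semialgebra_sub:
  assumes "S \<subseteq> carrier A" "\<zero> \<in> S" "\<one> \<in> S"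
    and "\<And>x y. x \<in> S \<Longrightarrow> y \<in> S \<Longrightarrow> x \<oplus> y \<in> S" "\<And>x y. x \<in> S \<Longrightarrow> y \<in> S \<Longrightarrow> x \<otimes> y \<in> S"
    and "\<And>q x. x \<in> S \<Longrightarrow> q \<odot> x \<in> S" "\<And>x. x \<in> S \<Longrightarrow> invol A x \<in> S"
  shows "inv_semialgebra (A\<lparr>carrier := S\<rparr>)"
proof -
  have sub: "x \<in> carrier A" if "x \<in> S" for x using assms(1) that by blast
  show ?thesis
    by unfold_locales
      (use assms(2-) in \<open>auto intro: a_comm simp: sub a_assoc m_assoc l_distr r_distr smult_l_distr
        smult_r_distr smult_assoc1 smult_one smult_l_null smult_r_null smult_assoc2 smult_assoc3
        invol_invol invol_add invol_mult invol_smult\<close>)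
qed

lemma (in inv_semialgebra) inv_semialgebra_corner:
  assumes e: "e \<in> carrier A" "e \<otimes> e = e" "invol A e = e"
    and central: "\<And>f. f \<in> carrier A \<Longrightarrow> e \<otimes> f = f \<otimes> e"
  shows "inv_semialgebra (corner A e)"
proof -
  define S where "S = {e \<otimes> f | f. f \<in> carrier A}"
  have corner: "corner A e = A\<lparr>carrier := S, one := e\<rparr>"
    by (simp add: corner_def S_def)
  \<comment> \<open>As \<open>e\<close> is idempotent, membership becomes an equation, and closure
    is then a calculation.\<close>
  have S: "x \<in> S \<longleftrightarrow> x \<in> carrier A \<and> e \<otimes> x = x" for x
  proof -
    have "e \<otimes> (e \<otimes> f) = e \<otimes> f" if "f \<in> carrier A" for f
      using e that by (simp flip: m_assoc)
    then show ?thesis using e(1) by (auto simp: S_def intro: exI[of _ x])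
  qed
  have right: "x \<otimes> e = x" if "x \<in> S" for x
    using that central[of x] by (simp add: S)
  have closed: "\<zero> \<in> S" "e \<in> S"
    "\<And>x y. x \<in> S \<Longrightarrow> y \<in> S \<Longrightarrow> x \<oplus> y \<in> S" "\<And>x y. x \<in> S \<Longrightarrow> y \<in> S \<Longrightarrow> x \<otimes> y \<in> S"
    "\<And>q x. x \<in> S \<Longrightarrow> q \<odot> x \<in> S"
    using e by (simp_all add: S r_distr smult_closed smult_assoc3 flip: m_assoc)
  \<comment> \<open>The involution reverses products, so \<open>x\<close> must be fixed by
    \<open>e\<close> on the right; centrality enters here through \<open>right\<close>.\<close>
  have closed': "invol A x \<in> S" if "x \<in> S" for x
    using invol_mult[of x e] right[OF that] that e invol_closed[of x] by (simp add: S)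
  have sub: "x \<in> carrier A" and left: "e \<otimes> x = x" if "x \<in> S" for x
    using that by (simp_all add: S)
  show ?thesis
    unfolding corner
    by unfold_locales
      (use closed closed' in \<open>auto intro: a_comm simp: sub left right a_assoc m_assoc
        l_distr r_distr smult_l_distr smult_r_distr smult_assoc1 smult_one smult_l_null
        smult_r_null smult_assoc2 smult_assoc3 invol_invol invol_add invol_mult invol_smult\<close>)
qed

section \<open>Diagonal idempotents\<close>

locale zdf_vN =
  fixes X :: "'x set" and A :: "('x, 'x, 'q::comm_inv_quantale) qrel set"
  assumes zdf: "\<And>x y :: 'q. x * y = bot \<Longrightarrow> x = bot \<or> y = bot"
    and vN: "vN_object X A"
begin

abbreviation V where "V \<equiv> vN_semialg X A"

lemma V_simps:
  "carrier V = A" "mult V = qcomp X X X" "one V = qid X" "zero V = qzero X X"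
  "add V = qjoin X X" "smult V = qscale X X" "invol V = qdagger X X"
  by (simp_all add: vN_semialg_def end_semialg_def)

lemma A_hom: "f \<in> A \<Longrightarrow> f \<in> qhom X X"
  using vN by (auto simp: vN_object_def)

lemma A_comm: "f \<in> A \<Longrightarrow> g \<in> A \<Longrightarrow> qcomp X X X f g = qcomp X X X g f"
  using vN by (auto simp: vN_object_def)

lemma A_comp: "f \<in> A \<Longrightarrow> g \<in> A \<Longrightarrow> qcomp X X X f g \<in> A"
  using vN by (auto simp: vN_object_def)

text \<open>The equation \<open>A = A''\<close> as a membership test; it brings indicators and glued
  matrices into \<open>A\<close>.\<close>

lemma A_iff:
  "f \<in> A \<longleftrightarrow> f \<in> qhom X X \<and> (\<forall>h\<in>commutant X A. qcomp X X X f h = qcomp X X X h f)"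
proof -
  have "A = commutant X (commutant X A)" using vN by (simp add: vN_object_def)
  then show ?thesis by (auto simp: commutant_def)
qed

text \<open>Rests on the commutativity of \<open>A\<close>; through it, facts about nonzero entries
  in the commutant also apply to \<open>A\<close>.\<close>

lemma A_sub_commutant: "A \<subseteq> commutant X A"
  using A_hom A_comm by (auto simp: commutant_def)

lemma inv_semialgebra_V: "inv_semialgebra V"
  unfolding vN_semialg_def
  by (rule inv_semialgebra.inv_semialgebra_sub[OF inv_semialgebra_end])
    (use vN in \<open>auto simp: vN_object_def end_semialg_def\<close>)

section \<open>Invariant sets and subunital idempotents\<close>

definition invariant :: "'x set \<Rightarrow> bool" where
  "invariant S \<longleftrightarrow> S \<subseteq> X \<and>
    (\<forall>h\<in>commutant X A. \<forall>x\<in>X. \<forall>y\<in>X. h (x, y) \<noteq> bot \<longrightarrow> (x \<in> S \<longleftrightarrow> y \<in> S))"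

text \<open>One composite of \<open>h\<close> with \<open>qdiag X S\<close> keeps the columns in
  \<open>S\<close>, the other the rows in \<open>S\<close>. They agree exactly if each nonzero entry
  of \<open>h\<close> has both coordinates in \<open>S\<close> or both outside.\<close>

lemma qdiag_in_A_iff:
  assumes "S \<subseteq> X"
  shows "qdiag X S \<in> A \<longleftrightarrow> invariant S"
proof -
  have "qcomp X X X (qdiag X S) h = qcomp X X X h (qdiag X S) \<longleftrightarrow>
      (\<forall>x\<in>X. \<forall>y\<in>X. h (x, y) \<noteq> bot \<longrightarrow> (x \<in> S \<longleftrightarrow> y \<in> S))" (is "?l = ?r \<longleftrightarrow> _")
    for h :: "('x, 'x, 'q) qrel"
  proof -
    have "?l = ?r \<longleftrightarrow> (\<forall>x\<in>X. \<forall>y\<in>X. ?l (x, y) = ?r (x, y))"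
      using qhom_eqI[OF qhom_closed(1) qhom_closed(1), of X X X "qdiag X S" h X h "qdiag X S"]
      by auto
    then show ?thesis
      by (simp only:) (intro ball_cong refl, auto simp: qcomp_qdiag_left qcomp_qdiag_right)
  qed
  then show ?thesis
    using assms by (simp add: A_iff[of "qdiag X S"] qdiag_closed invariant_def)
qed

lemma subunital_idempotentI:
  assumes "invariant S"
  shows "subunital_idempotent V (qdiag X S)"
proof -
  have "invariant (X - S)" "S \<union> (X - S) = X"
    using assms by (auto simp: invariant_def)
  then show ?thesis
    using assms qdiag_in_A_iff unfolding subunital_idempotent_def V_simps
    by (intro conjI bexI[of _ "qdiag X (X - S)"])
      (auto simp: qcomp_qdiag_qdiag qjoin_qdiag_qdiag qzero_eq_qdiag qid_eq_qdiag invariant_def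
        Int_Diff)
qed

text \<open>Addition is a join, so \<open>p + q = 1\<close> makes \<open>p\<close> vanish off the
  diagonal. On the diagonal, \<open>p\<close> or \<open>q\<close> vanishes for lack of zero
  divisors, and the other one is then \<open>1\<close>.\<close>

lemma subunital_idempotentE:
  assumes "subunital_idempotent V p"
  obtains S where "invariant S" "p = qdiag X S"
proof -
  obtain q where p: "p \<in> A" and pq: "qcomp X X X p q = qzero X X" "qjoin X X p q = qid X"
    using assms by (auto simp: subunital_idempotent_def V_simps)
  have off: "p (x, y) = bot" if "x \<in> X" "y \<in> X" "x \<noteq> y" for x y
    using fun_cong[OF pq(2), of "(x, y)"] that by (simp add: qrel_apply)
  have diag: "p (x, x) = bot \<or> p (x, x) = 1" if x: "x \<in> X" for x
  proof -
    \<comment> \<open>This product is the term with intermediate point \<open>x\<close> in the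
      supremum for the composite, which is zero.\<close>
    have "q (x, x) * p (x, x) \<le> qcomp X X X p q (x, x)"
      using x by (auto simp: qrel_apply intro: SUP_upper)
    then have "q (x, x) * p (x, x) = bot"
      using x by (simp add: pq qrel_apply bot_unique)
    moreover have "sup (p (x, x)) (q (x, x)) = 1"
      using fun_cong[OF pq(2), of "(x, x)"] x by (simp add: qrel_apply)
    ultimately show ?thesis using zdf by fastforce
  qed
  define S where "S = {x \<in> X. p (x, x) = 1}"
  have "p = qdiag X S"
    using off diag by (intro qhom_eqI[OF A_hom[OF p] qdiag_closed]) (auto simp: qdiag_apply S_def)
  moreover have "S \<subseteq> X" by (auto simp: S_def)
  ultimately show ?thesis using that p qdiag_in_A_iff by blast
qed

text \<open>These are the connected components of the relation that some \<open>h\<close> in the commutant has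
  \<open>h (x, y) \<noteq> 0\<close>; defining them by separation through invariant sets avoids a transitive
  closure.\<close>

definition component :: "'x \<Rightarrow> 'x set" where
  "component x = {y \<in> X. \<forall>S. invariant S \<longrightarrow> (x \<in> S \<longleftrightarrow> y \<in> S)}"

text \<open>The two coordinates of a nonzero entry lie in the same invariant sets, hence in the same
  components.\<close>

lemma invariant_component: "invariant (component x)"
  by (auto simp: invariant_def component_def)

lemma component_subset: "component x \<subseteq> X"
  by (auto simp: component_def)

lemma component_self: "x \<in> X \<Longrightarrow> x \<in> component x"
  by (simp add: component_def)

lemma component_eq: "y \<in> component x \<Longrightarrow> component y = component x"
  by (auto simp: component_def)

text \<open>The block diagonal form of the commutant.\<close>

lemma component_eq_of_commutant:
  assumes "h \<in> commutant X A" "x \<in> X" "y \<in> X" "h (x, y) \<noteq> bot"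
  shows "component y = component x"
  using assms invariant_component[of x] component_self component_eq
  unfolding invariant_def by metis

text \<open>A point of \<open>S\<close> is not separated from \<open>x\<close> by \<open>S\<close>,
  so \<open>x\<close> and with it the whole component lie in \<open>S\<close>.\<close>

lemma component_minimal:
  assumes "invariant S" "S \<subseteq> component x" "S \<noteq> {}"
  shows "S = component x"
  using assms unfolding component_def by blast

lemma primitive_component:
  assumes x: "x \<in> X"
  shows "primitive_subunital_idempotent V (qdiag X (component x))"
proof -
  \<comment> \<open>Minimality of the component leaves the first summand only the values that
    primitivity excludes.\<close>
  have "p \<in> {\<zero>\<^bsub>V\<^esub>, qdiag X (component x)}"
    if p: "subunital_idempotent V p" and q: "subunital_idempotent V q"
      and eq: "qdiag X (component x) = p \<oplus>\<^bsub>V\<^esub> q" for p q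
  proof -
    obtain S where S: "invariant S" "p = qdiag X S" using p by (rule subunital_idempotentE)
    obtain T where T: "invariant T" "q = qdiag X T" using q by (rule subunital_idempotentE)
    have "S \<subseteq> X" "T \<subseteq> X" using S T by (auto simp: invariant_def)
    then have "component x = S \<union> T"
      using eq unfolding S T V_simps qjoin_qdiag_qdiag
      by (subst (asm) qdiag_eq_iff) (use component_subset in auto)
    then have "S = {} \<or> S = component x" using component_minimal S by blast
    then show ?thesis using S by (auto simp: V_simps qzero_eq_qdiag)
  qed
  moreover have "qdiag X (component x) \<noteq> \<zero>\<^bsub>V\<^esub>"
    using component_self[OF x] component_subset by (auto simp: V_simps qzero_eq_qdiag qdiag_eq_iff)
  ultimately show ?thesis
    unfolding primitive_subunital_idempotent_def
    using subunital_idempotentI[OF invariant_component] by blast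
qed

section \<open>The decomposition\<close>

abbreviation E where "E x \<equiv> qdiag X (component x)"

lemma E_in_A: "E x \<in> A"
  using qdiag_in_A_iff[OF component_subset] invariant_component by blast

lemma corner_carrier:
  "f \<in> carrier (corner V (E x)) \<longleftrightarrow> f \<in> A \<and> qcomp X X X (E x) f = f"
proof -
  have "qcomp X X X (E x) (qcomp X X X (E x) f) = qcomp X X X (E x) f" for f
    by (simp add: qcomp_assoc qcomp_qdiag_qdiag)
  then show ?thesis
    using A_comp[OF E_in_A] by (auto simp: corner_def V_simps) metis
qed

lemma inv_semialgebra_corner_V: "inv_semialgebra (corner V (E x))"
  by (rule inv_semialgebra.inv_semialgebra_corner[OF inv_semialgebra_V])
    (simp_all add: V_simps E_in_A qcomp_qdiag_qdiag qdagger_qdiag A_comm)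

text \<open>Column \<open>y\<close> survives composition with \<open>E y\<close>, because
  \<open>y\<close> lies in its own component.\<close>

lemma corners_separate:
  assumes f: "f \<in> A" and g: "g \<in> A"
    and eq: "\<And>x. x \<in> X \<Longrightarrow> qcomp X X X (E x) f = qcomp X X X (E x) g"
  shows "f = g"
proof (rule qhom_eqI[OF A_hom[OF f] A_hom[OF g]])
  fix x y assume "x \<in> X" "y \<in> X"
  then show "f (x, y) = g (x, y)"
    using fun_cong[OF eq[of y], of "(x, y)"] component_self by (simp add: qcomp_qdiag_left)
qed

lemma corners_glue:
  assumes F: "\<And>x. x \<in> X \<Longrightarrow> F (E x) \<in> A \<and> qcomp X X X (E x) (F (E x)) = F (E x)"
  obtains f where "f \<in> A" "\<And>x. x \<in> X \<Longrightarrow> qcomp X X X (E x) f = F (E x)"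
proof
  \<comment> \<open>Row \<open>x\<close> comes from the block of its component. Indexing
    \<open>F\<close> by idempotents makes this choice the same for all points of a
    component.\<close>
  define f where "f = (\<lambda>(x, y)\<in>X \<times> X. F (E x) (x, y))"
  have f_hom: "f \<in> qhom X X" by (auto simp: f_def qhom_def PiE_def extensional_def)
  have f_apply: "f (x, y) = F (E x) (x, y)" if "x \<in> X" "y \<in> X" for x y
    using that by (simp add: f_def)
  have "qcomp X X X f h = qcomp X X X h f" if h: "h \<in> commutant X A" for h
  proof (rule qhom_eqI[OF qhom_closed(1) qhom_closed(1)])
    fix x z assume x: "x \<in> X" and z: "z \<in> X"
    \<comment> \<open>Where \<open>h (x, y)\<close> is nonzero, \<open>E y = E x\<close>, so a
      single block \<open>F (E x)\<close> replaces \<open>f\<close>.\<close>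
    have "h (x, y) * f (y, z) = h (x, y) * F (E x) (y, z)" if "y \<in> X" for y
      using component_eq_of_commutant[OF h x that] f_apply[OF that z]
      by (cases "h (x, y) = bot") (simp_all add: bot_mult)
    then have "qcomp X X X f h (x, z) = qcomp X X X (F (E x)) h (x, z)"
      using x z by (simp add: qrel_apply)
    also have "\<dots> = qcomp X X X h (F (E x)) (x, z)"
      using F[OF x] h by (simp add: commutant_def)
    also have "\<dots> = qcomp X X X h f (x, z)"
      using x z by (simp add: qrel_apply f_apply)
    finally show "qcomp X X X f h (x, z) = qcomp X X X h f (x, z)" .
  qed
  then show "f \<in> A" using f_hom A_iff by blast
  fix c assume c: "c \<in> X"
  show "qcomp X X X (E c) f = F (E c)"
  proof (rule qhom_eqI[OF qhom_closed(1)])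
    show "F (E c) \<in> qhom X X" using F[OF c] A_hom by blast
    fix x z assume x: "x \<in> X" and z: "z \<in> X"
    \<comment> \<open>The given blocks lie in \<open>A\<close>, hence in the commutant, and vanish
      between different components.\<close>
    have supp: "F (E a) (x, z) = bot" if a: "a \<in> X" and ne: "component z \<noteq> component x" for a
      using component_eq_of_commutant[of "F (E a)" x z] F[OF a] A_sub_commutant x z ne by blast
    show "qcomp X X X (E c) f (x, z) = F (E c) (x, z)"
    proof (cases "z \<in> component c")
      case True
      then have "component z = component c" by (rule component_eq)
      then show ?thesis
        \<comment> \<open>In the same component both sides use the same block; otherwise
          \<open>supp\<close> makes both entries zero.\<close>
        using True x z c supp[OF x] supp[OF c]
        by (cases "component x = component c") (simp_all add: qcomp_qdiag_left f_apply)
    next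
      case False
      have "F (E c) (x, z) = qcomp X X X (E c) (F (E c)) (x, z)" using F[OF c] by simp
      then show ?thesis using False x z by (simp add: qcomp_qdiag_left)
    qed
  qed
qed

text \<open>The index set is the image of \<open>E\<close>: indexing by points would repeat the
  factor of a component with several points and destroy surjectivity.\<close>

lemma direct_product: "is_direct_product_of_corners V (E ` X) id"
proof -
  interpret inv_semialgebra V by (rule inv_semialgebra_V)
  let ?h = "\<lambda>f. \<lambda>i\<in>E ` X. i \<otimes>\<^bsub>V\<^esub> f"
  let ?P = "inv_semialg_prod (E ` X) (corner V)"
  have h_apply: "?h f (E x) = qcomp X X X (E x) f" if "x \<in> X" for f x
    using that by (simp add: V_simps)
  have "bij_betw ?h (carrier V) (carrier ?P)"
    unfolding bij_betw_def
  proof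
    show "inj_on ?h (carrier V)"
    proof (rule inj_onI)
      fix f g assume "f \<in> carrier V" "g \<in> carrier V" "?h f = ?h g"
      then show "f = g"
        using corners_separate[of f g] h_apply by (metis V_simps(1))
    qed
    have "F \<in> ?h ` carrier V" if F: "F \<in> carrier ?P" for F
    proof -
      have FE: "F (E x) \<in> A \<and> qcomp X X X (E x) (F (E x)) = F (E x)" if "x \<in> X" for x
        using F that corner_carrier[of "F (E x)" x] by (auto simp: inv_semialg_prod_def)
      obtain f where f: "f \<in> A" "\<And>x. x \<in> X \<Longrightarrow> qcomp X X X (E x) f = F (E x)"
        using corners_glue[OF FE] by blast
      have "F = ?h f"
        using F f by (intro extensionalityI[of _ "E ` X"]) (auto simp: inv_semialg_prod_def PiE_def V_simps)
      then show ?thesis using f by (auto simp: V_simps)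
    qed
    moreover have "?h f \<in> carrier ?P" if "f \<in> carrier V" for f
      using that by (auto simp: inv_semialg_prod_def corner_def)
    ultimately show "?h ` carrier V = carrier ?P" by blast
  qed
  moreover have "E x \<otimes>\<^bsub>V\<^esub> (f \<otimes>\<^bsub>V\<^esub> g) = E x \<otimes>\<^bsub>V\<^esub> f \<otimes>\<^bsub>V\<^esub> (E x \<otimes>\<^bsub>V\<^esub> g)"
    if "f \<in> carrier V" "g \<in> carrier V" for x f g
  proof -
    \<comment> \<open>Commutativity of \<open>A\<close> brings the two copies of \<open>E x\<close>
      together, and idempotence merges them.\<close>
    have "E x \<otimes>\<^bsub>V\<^esub> f \<otimes>\<^bsub>V\<^esub> (E x \<otimes>\<^bsub>V\<^esub> g) = E x \<otimes>\<^bsub>V\<^esub> (f \<otimes>\<^bsub>V\<^esub> E x) \<otimes>\<^bsub>V\<^esub> g"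
      by (simp add: V_simps qcomp_assoc)
    also have "f \<otimes>\<^bsub>V\<^esub> E x = E x \<otimes>\<^bsub>V\<^esub> f"
      using that A_comm E_in_A by (simp add: V_simps)
    finally show ?thesis by (simp add: V_simps qcomp_assoc qcomp_qdiag_qdiag)
  qed
  moreover have "E x \<otimes>\<^bsub>V\<^esub> invol V f = invol V (E x \<otimes>\<^bsub>V\<^esub> f)" if f: "f \<in> carrier V" for x f
  proof -
    have "invol V (E x \<otimes>\<^bsub>V\<^esub> f) = invol V f \<otimes>\<^bsub>V\<^esub> invol V (E x)"
      using f E_in_A by (intro invol_mult) (simp_all add: V_simps)
    also have "\<dots> = E x \<otimes>\<^bsub>V\<^esub> invol V f"
      using invol_closed[OF f] E_in_A A_comm by (simp add: V_simps qdagger_qdiag)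
    finally show ?thesis ..
  qed
  moreover have "E x \<in> carrier V" for x
    by (simp add: V_simps E_in_A)
  ultimately have "?h \<in> inv_semialg_iso V ?P"
    unfolding inv_semialg_iso_def inv_semialg_prod_def
    by (auto simp: corner_def r_distr smult_assoc3 simp del: mem_Collect_eq intro!: restrict_ext)
  then show ?thesis
    unfolding is_direct_product_of_corners_def
    using inv_semialgebra_V inv_semialgebra_corner_V by (auto simp: id_def)
qed

end

theorem theorem24:
  fixes X :: "'x set" and A :: "('x, 'x, 'q::comm_inv_quantale) qrel set"
  assumes zdf: "\<And>x y :: 'q. x * y = bot \<Longrightarrow> x = bot \<or> y = bot"
    and A: "vN_object X A"
  shows "\<exists>(I :: ('x, 'x, 'q) qrel set) (e :: ('x, 'x, 'q) qrel \<Rightarrow> ('x, 'x, 'q) qrel).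
    (\<forall>i\<in>I. primitive_subunital_idempotent (vN_semialg X A) (e i)) \<and>
    is_direct_product_of_corners (vN_semialg X A) I e"
proof -
  interpret zdf_vN X A using assms by unfold_locales auto
  have "\<forall>i\<in>E ` X. primitive_subunital_idempotent V (id i)"
    using primitive_component by auto
  then show ?thesis using direct_product by blast
qed

end
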